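(* Let $\pi$ be a commutative semigroup and let $(\{A_\varphi\}_{\varphi\in\pi},\{\star_{p,q}\}_{p,q\in\pi},\{\ast_{p,q}\}_{p,q\in\pi})$ be a pre-Poisson T-algebra. Define $$a\diamond_{p,q}b:=a\star_{p,q}b+b\star_{q,p}a,\qquad [a,b]_{p,q}:=a\ast_{p,q}b-b\ast_{q,p}a$$ for $a\in A_p$, $b\in A_q$ and $p,q\in\pi$. Then $(\{A_\varphi\}_{\varphi\in\pi},\{\diamond_{p,q}\}_{p,q\in\pi},\{[,]_{p,q}\}_{p,q\in\pi})$ is a Poisson T-algebra.
   Context: $K$ is a field; all vector spaces, tensor products and linear maps are over $K$. Let $\pi$ be a commutative semigroup; all identities below are required for all $p,q,t\in\pi$, $a\in A_p,b\in A_q,c\in A_t$, and each operation indexed by $(p,q)$ is a linear map $A_p\otimes A_q\to A_{pq}$ on a family of vector spaces $\{A_\varphi\}_{\varphi\in\pi}$. T-algebra: operations $\cdot_{p,q}$ with $(a\cdot_{p,q}b)\cdot_{pq,t}c=a\cdot_{p,qt}(b\cdot_{q,t}c)$. It is commutative if $a\cdot_{p,q}b=b\cdot_{q,p}a$. Lie T-algebra: operations $[,]_{p,q}$ with $[a,b]_{p,q}+[b,a]_{q,p}=0$ and $[[a,b]_{p,q},c]_{pq,t}+[[b,c]_{q,t},a]_{qt,p}+[[c,a]_{t,p},b]_{tp,q}=0$. Poisson T-algebra: a triple $(\{A_\varphi\},\{\cdot_{p,q}\},\{[,]_{p,q}\})$ where $(\{A_\varphi\},\{\cdot_{p,q}\})$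 is a commutative T-algebra, $(\{A_\varphi\},\{[,]_{p,q}\})$ is a Lie T-algebra, and $[a,b\cdot_{q,t}c]_{p,qt}=[a,b]_{p,q}\cdot_{pq,t}c+b\cdot_{q,pt}[a,c]_{p,t}$. Zinbiel T-algebra: operations $\star_{p,q}$ with $a\star_{p,qt}(b\star_{q,t}c)=(a\star_{p,q}b)\star_{pq,t}c+(b\star_{q,p}a)\star_{qp,t}c$. Pre-Lie T-algebra: operations $\ast_{p,q}$ with $a\ast_{p,qt}(b\ast_{q,t}c)-(a\ast_{p,q}b)\ast_{pq,t}c=b\ast_{q,pt}(a\ast_{p,t}c)-(b\ast_{q,p}a)\ast_{qp,t}c$. Pre-Poisson T-algebra: a triple $(\{A_\varphi\},\{\star_{p,q}\},\{\ast_{p,q}\})$ where $(\{A_\varphi\},\{\star_{p,q}\})$ is a Zinbiel T-algebra, $(\{A_\varphi\},\{\ast_{p,q}\})$ is a pre-Lie T-algebra, and $(a\ast_{p,q}b)\star_{pq,t}c-(b\ast_{q,p}a)\star_{qp,t}c=a\ast_{p,qt}(b\star_{q,t}c)-b\star_{q,pt}(a\ast_{p,t}c)$, $(a\star_{p,q}b)\ast_{pq,t}c+(b\star_{q,p}a)\ast_{qp,t}c=a\star_{p,qt}(b\ast_{q,t}c)+b\star_{q,pt}(a\ast_{p,t}c)$. *)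

theory Defs
  imports "HOL-Algebra.Module"
begin

text \<open>
  The commutative semigroup of indices is the type \<open>'p\<close>. The members of the family
  \<open>A\<close> are separate modules over the field \<open>K\<close>, each with its own carrier, addition,
  zero and scalar multiplication; only the ambient type of the elements is shared.
\<close>

locale vector_space_family = field K
  for K :: "('k, 'r) ring_scheme" +
  fixes A :: "'p::ab_semigroup_mult \<Rightarrow> ('k, 'v, 'm) module_scheme"
  assumes vector_space: "module K (A p)"

text \<open>
  A linear map from the tensor product of \<open>A p\<close> and \<open>A q\<close> to \<open>A (p * q)\<close> is given by the
  corresponding bilinear map, written \<open>f p q a b\<close>.
\<close>

locale T_operation = vector_space_family K A
  for K :: "('k, 'r) ring_scheme"
    and A :: "'p::ab_semigroup_mult \<Rightarrow> ('k, 'v, 'm) module_scheme" +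
  fixes f :: "'p \<Rightarrow> 'p \<Rightarrow> 'v \<Rightarrow> 'v \<Rightarrow> 'v"
  assumes closed:
      "\<lbrakk>a \<in> carrier (A p); b \<in> carrier (A q)\<rbrakk> \<Longrightarrow> f p q a b \<in> carrier (A (p * q))"
    and add_left:
      "\<lbrakk>a \<in> carrier (A p); a' \<in> carrier (A p); b \<in> carrier (A q)\<rbrakk> \<Longrightarrow>
        f p q (a \<oplus>\<^bsub>A p\<^esub> a') b = f p q a b \<oplus>\<^bsub>A (p * q)\<^esub> f p q a' b"
    and add_right:
      "\<lbrakk>a \<in> carrier (A p); b \<in> carrier (A q); b' \<in> carrier (A q)\<rbrakk> \<Longrightarrow>
        f p q a (b \<oplus>\<^bsub>A q\<^esub> b') = f p q a b \<oplus>\<^bsub>A (p * q)\<^esub> f p q a b'"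
    and smult_left:
      "\<lbrakk>k \<in> carrier K; a \<in> carrier (A p); b \<in> carrier (A q)\<rbrakk> \<Longrightarrow>
        f p q (k \<odot>\<^bsub>A p\<^esub> a) b = k \<odot>\<^bsub>A (p * q)\<^esub> f p q a b"
    and smult_right:
      "\<lbrakk>k \<in> carrier K; a \<in> carrier (A p); b \<in> carrier (A q)\<rbrakk> \<Longrightarrow>
        f p q a (k \<odot>\<^bsub>A q\<^esub> b) = k \<odot>\<^bsub>A (p * q)\<^esub> f p q a b"

locale T_algebra = T_operation K A mul
  for K :: "('k, 'r) ring_scheme"
    and A :: "'p::ab_semigroup_mult \<Rightarrow> ('k, 'v, 'm) module_scheme"
    and mul :: "'p \<Rightarrow> 'p \<Rightarrow> 'v \<Rightarrow> 'v \<Rightarrow> 'v" +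
  assumes T_assoc:
      "\<lbrakk>a \<in> carrier (A p); b \<in> carrier (A q); c \<in> carrier (A t)\<rbrakk> \<Longrightarrow>
        mul (p * q) t (mul p q a b) c = mul p (q * t) a (mul q t b c)"

locale comm_T_algebra = T_algebra K A mul
  for K :: "('k, 'r) ring_scheme"
    and A :: "'p::ab_semigroup_mult \<Rightarrow> ('k, 'v, 'm) module_scheme"
    and mul :: "'p \<Rightarrow> 'p \<Rightarrow> 'v \<Rightarrow> 'v \<Rightarrow> 'v" +
  assumes T_comm:
      "\<lbrakk>a \<in> carrier (A p); b \<in> carrier (A q)\<rbrakk> \<Longrightarrow> mul p q a b = mul q p b a"

locale Lie_T_algebra = T_operation K A br
  for K :: "('k, 'r) ring_scheme"
    and A :: "'p::ab_semigroup_mult \<Rightarrow> ('k, 'v, 'm) module_scheme"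
    and br :: "'p \<Rightarrow> 'p \<Rightarrow> 'v \<Rightarrow> 'v \<Rightarrow> 'v" +
  assumes skew:
      "\<lbrakk>a \<in> carrier (A p); b \<in> carrier (A q)\<rbrakk> \<Longrightarrow>
        br p q a b \<oplus>\<^bsub>A (p * q)\<^esub> br q p b a = \<zero>\<^bsub>A (p * q)\<^esub>"
    and jacobi:
      "\<lbrakk>a \<in> carrier (A p); b \<in> carrier (A q); c \<in> carrier (A t)\<rbrakk> \<Longrightarrow>
        br (p * q) t (br p q a b) c
          \<oplus>\<^bsub>A (p * q * t)\<^esub> br (q * t) p (br q t b c) a
          \<oplus>\<^bsub>A (p * q * t)\<^esub> br (t * p) q (br t p c a) b = \<zero>\<^bsub>A (p * q * t)\<^esub>"

locale Poisson_T_algebra = comm_T_algebra K A mul + Lie: Lie_T_algebra K A br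
  for K :: "('k, 'r) ring_scheme"
    and A :: "'p::ab_semigroup_mult \<Rightarrow> ('k, 'v, 'm) module_scheme"
    and mul br :: "'p \<Rightarrow> 'p \<Rightarrow> 'v \<Rightarrow> 'v \<Rightarrow> 'v" +
  assumes leibniz:
      "\<lbrakk>a \<in> carrier (A p); b \<in> carrier (A q); c \<in> carrier (A t)\<rbrakk> \<Longrightarrow>
        br p (q * t) a (mul q t b c) =
          mul (p * q) t (br p q a b) c
            \<oplus>\<^bsub>A (p * q * t)\<^esub> mul q (p * t) b (br p t a c)"

locale Zinbiel_T_algebra = T_operation K A star
  for K :: "('k, 'r) ring_scheme"
    and A :: "'p::ab_semigroup_mult \<Rightarrow> ('k, 'v, 'm) module_scheme"
    and star :: "'p \<Rightarrow> 'p \<Rightarrow> 'v \<Rightarrow> 'v \<Rightarrow> 'v" +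
  assumes zinbiel:
      "\<lbrakk>a \<in> carrier (A p); b \<in> carrier (A q); c \<in> carrier (A t)\<rbrakk> \<Longrightarrow>
        star p (q * t) a (star q t b c) =
          star (p * q) t (star p q a b) c
            \<oplus>\<^bsub>A (p * q * t)\<^esub> star (q * p) t (star q p b a) c"

locale pre_Lie_T_algebra = T_operation K A ast
  for K :: "('k, 'r) ring_scheme"
    and A :: "'p::ab_semigroup_mult \<Rightarrow> ('k, 'v, 'm) module_scheme"
    and ast :: "'p \<Rightarrow> 'p \<Rightarrow> 'v \<Rightarrow> 'v \<Rightarrow> 'v" +
  assumes pre_Lie:
      "\<lbrakk>a \<in> carrier (A p); b \<in> carrier (A q); c \<in> carrier (A t)\<rbrakk> \<Longrightarrow>
        ast p (q * t) a (ast q t b c) \<ominus>\<^bsub>A (p * q * t)\<^esub> ast (p * q) t (ast p q a b) c =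
        ast q (p * t) b (ast p t a c) \<ominus>\<^bsub>A (p * q * t)\<^esub> ast (q * p) t (ast q p b a) c"

locale pre_Poisson_T_algebra = Zinbiel_T_algebra K A star + pre_Lie: pre_Lie_T_algebra K A ast
  for K :: "('k, 'r) ring_scheme"
    and A :: "'p::ab_semigroup_mult \<Rightarrow> ('k, 'v, 'm) module_scheme"
    and star ast :: "'p \<Rightarrow> 'p \<Rightarrow> 'v \<Rightarrow> 'v \<Rightarrow> 'v" +
  assumes compat_star:
      "\<lbrakk>a \<in> carrier (A p); b \<in> carrier (A q); c \<in> carrier (A t)\<rbrakk> \<Longrightarrow>
        star (p * q) t (ast p q a b) c \<ominus>\<^bsub>A (p * q * t)\<^esub> star (q * p) t (ast q p b a) c =
        ast p (q * t) a (star q t b c) \<ominus>\<^bsub>A (p * q * t)\<^esub> star q (p * t) b (ast p t a c)"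
    and compat_ast:
      "\<lbrakk>a \<in> carrier (A p); b \<in> carrier (A q); c \<in> carrier (A t)\<rbrakk> \<Longrightarrow>
        ast (p * q) t (star p q a b) c \<oplus>\<^bsub>A (p * q * t)\<^esub> ast (q * p) t (star q p b a) c =
        star p (q * t) a (ast q t b c) \<oplus>\<^bsub>A (p * q * t)\<^esub> star q (p * t) b (ast p t a c)"

end

theory Submission
  imports Defs
begin

text \<open>Associativity of the anticommutator follows by expanding every a * (b * c) with the Zinbiel
  identity. The Jacobi identity is the sum of the pre-Lie identities for the three cyclic
  permutations of (a, b, c), and the Leibniz rule is the sum of the first compatibility for (a, b, c)
  and (a, c, b) and the second one for (b, c, a).\<close>

context abelian_group
begin

lemma diff_eq_iff:
  assumes "x \<in> carrier G" "y \<in> carrier G" "z \<in> carrier G"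
  shows "x \<ominus> y = z \<longleftrightarrow> x = z \<oplus> y"
proof
  assume "x \<ominus> y = z"
  then have "z \<oplus> y = x \<oplus> (\<ominus> y \<oplus> y)"
    using assms by (auto simp: minus_eq a_assoc)
  then show "x = z \<oplus> y"
    using assms by (simp add: l_neg)
next
  assume "x = z \<oplus> y"
  then show "x \<ominus> y = z"
    using assms by (simp add: minus_eq a_assoc r_neg)
qed

lemma eq_diff_iff:
  "\<lbrakk>x \<in> carrier G; y \<in> carrier G; z \<in> carrier G\<rbrakk> \<Longrightarrow> x = z \<ominus> y \<longleftrightarrow> x \<oplus> y = z"
  using diff_eq_iff[of z y x] by auto

lemma diff_eq_zero_iff:
  "\<lbrakk>x \<in> carrier G; y \<in> carrier G\<rbrakk> \<Longrightarrow> x \<ominus> y = \<zero> \<longleftrightarrow> x = y"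
  by (simp add: diff_eq_iff)

lemma add_diff_eq:
  "\<lbrakk>x \<in> carrier G; y \<in> carrier G; z \<in> carrier G\<rbrakk> \<Longrightarrow> x \<oplus> (y \<ominus> z) = (x \<oplus> y) \<ominus> z"
  by (simp add: minus_eq a_assoc)

lemma diff_add_eq:
  "\<lbrakk>x \<in> carrier G; y \<in> carrier G; z \<in> carrier G\<rbrakk> \<Longrightarrow> (x \<ominus> y) \<oplus> z = (x \<oplus> z) \<ominus> y"
  by (simp add: minus_eq a_ac)

lemma diff_diff_eq:
  "\<lbrakk>x \<in> carrier G; y \<in> carrier G; z \<in> carrier G\<rbrakk> \<Longrightarrow> x \<ominus> y \<ominus> z = x \<ominus> (y \<oplus> z)"
  by (simp add: minus_eq minus_add a_assoc)

lemma diff_diff_eq2: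
  "\<lbrakk>x \<in> carrier G; y \<in> carrier G; z \<in> carrier G\<rbrakk> \<Longrightarrow> x \<ominus> (y \<ominus> z) = (x \<oplus> z) \<ominus> y"
  by (simp add: minus_eq minus_add minus_minus a_ac)

text \<open>Read from left to right, these rules pull every subtraction outwards and then carry it
  across the equation, so that an equation with differences becomes one between sums. Equations to
  zero, as in skew-symmetry and the Jacobi identity, are served by
  \<open>diff_eq_zero_iff\<close>.\<close>

lemmas diff_simps =
  diff_eq_zero_iff diff_eq_iff eq_diff_iff add_diff_eq diff_add_eq diff_diff_eq diff_diff_eq2

end

context vector_space_family
begin

text \<open>Each index has its own group, and one calculation may meet several of them.
  Instantiating the group laws with this fact leaves \<open>p\<close> schematic, so that they apply
  at whichever index occurs.\<close>

lemma abelian_group_member: "abelian_group (A p)"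
  using vector_space[of p] by (simp add: module_def)

lemmas member_simps =
  abelian_group.a_inv_closed[OF abelian_group_member]
  abelian_group.minus_closed[OF abelian_group_member]
  abelian_monoid.a_closed[OF abelian_group.axioms(1)[OF abelian_group_member]]

lemmas member_ac =
  abelian_monoid.a_assoc[OF abelian_group.axioms(1)[OF abelian_group_member]]
  abelian_monoid.a_comm[OF abelian_group.axioms(1)[OF abelian_group_member]]
  abelian_monoid.a_lcomm[OF abelian_group.axioms(1)[OF abelian_group_member]]

lemmas member_diff_simps = abelian_group.diff_simps[OF abelian_group_member]

text \<open>Brings products of indices to a common normal form, so that terms and additions over
  \<open>A (p * q * t)\<close> and \<open>A (q * t * p)\<close> become syntactically
  comparable.\<close>

lemmas index_ac = mult.assoc mult.commute[where 'a = 'p] mult.left_commute[where 'a = 'p]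

end

context T_operation
begin

text \<open>The target index is a separate variable \<open>r\<close>, so that membership can still
  be shown after the product of indices has been rewritten to another form.\<close>

lemma closed_at:
  "\<lbrakk>a \<in> carrier (A p); b \<in> carrier (A q); p * q = r\<rbrakk> \<Longrightarrow> f p q a b \<in> carrier (A r)"
  using closed by blast

text \<open>Negation is multiplication by the scalar -1, so homogeneity carries it through the
  operation.\<close>

lemma minus_left:
  assumes "a \<in> carrier (A p)" "b \<in> carrier (A q)"
  shows "f p q (\<ominus>\<^bsub>A p\<^esub> a) b = \<ominus>\<^bsub>A (p * q)\<^esub> f p q a b"
proof -
  have "f p q ((\<ominus>\<^bsub>K\<^esub> \<one>\<^bsub>K\<^esub>) \<odot>\<^bsub>A p\<^esub> a) b = (\<ominus>\<^bsub>K\<^esub> \<one>\<^bsub>K\<^esub>) \<odot>\<^bsub>A (p * q)\<^esub> f p q a b"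
    using assms by (simp add: smult_left)
  then show ?thesis
    using assms closed
    by (simp add: module.smult_l_minus[OF vector_space] module.smult_one[OF vector_space])
qed

lemma minus_right:
  assumes "a \<in> carrier (A p)" "b \<in> carrier (A q)"
  shows "f p q a (\<ominus>\<^bsub>A q\<^esub> b) = \<ominus>\<^bsub>A (p * q)\<^esub> f p q a b"
proof -
  have "f p q a ((\<ominus>\<^bsub>K\<^esub> \<one>\<^bsub>K\<^esub>) \<odot>\<^bsub>A q\<^esub> b) = (\<ominus>\<^bsub>K\<^esub> \<one>\<^bsub>K\<^esub>) \<odot>\<^bsub>A (p * q)\<^esub> f p q a b"
    using assms by (simp add: smult_right)
  then show ?thesis
    using assms closed
    by (simp add: module.smult_l_minus[OF vector_space] module.smult_one[OF vector_space])
qed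

lemma diff_left:
  "\<lbrakk>a \<in> carrier (A p); a' \<in> carrier (A p); b \<in> carrier (A q)\<rbrakk> \<Longrightarrow>
    f p q (a \<ominus>\<^bsub>A p\<^esub> a') b = f p q a b \<ominus>\<^bsub>A (p * q)\<^esub> f p q a' b"
  by (simp add: a_minus_def add_left minus_left member_simps)

lemma diff_right:
  "\<lbrakk>a \<in> carrier (A p); b \<in> carrier (A q); b' \<in> carrier (A q)\<rbrakk> \<Longrightarrow>
    f p q a (b \<ominus>\<^bsub>A q\<^esub> b') = f p q a b \<ominus>\<^bsub>A (p * q)\<^esub> f p q a b'"
  by (simp add: a_minus_def add_right minus_right member_simps)

text \<open>The swapped value lies in \<open>A (q * p)\<close>, which is \<open>A (p * q)\<close>
  because the semigroup is commutative. Together with sums and differences this makes both derived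
  operations bilinear.\<close>

lemma T_operation_opposite: "T_operation K A (\<lambda>p q a b. f q p b a)"
proof unfold_locales
  fix p q a b assume "a \<in> carrier (A p)" "b \<in> carrier (A q)"
  then show "f q p b a \<in> carrier (A (p * q))"
    using closed[of b q a p] by (simp add: mult.commute)
qed (simp_all add: add_left add_right smult_left smult_right mult.commute)

lemma T_operation_add:
  assumes "T_operation K A g"
  shows "T_operation K A (\<lambda>p q a b. f p q a b \<oplus>\<^bsub>A (p * q)\<^esub> g p q a b)"
proof -
  interpret g: T_operation K A g by fact
  note [simp] = closed g.closed member_simps
  show ?thesis
    by unfold_locales
      (simp_all add: add_left g.add_left add_right g.add_right smult_left g.smult_left
        smult_right g.smult_right module.smult_r_distr[OF vector_space]
        member_ac)
qed

lemma T_operation_uminus: "T_operation K A (\<lambda>p q a b. \<ominus>\<^bsub>A (p * q)\<^esub> f p q a b)"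
  by unfold_locales
    (simp_all add: closed member_simps add_left add_right smult_left smult_right
      abelian_group.minus_add[OF abelian_group_member] module.smult_r_minus[OF vector_space])

end

lemma T_operation_diff:
  assumes "T_operation K A f" "T_operation K A g"
  shows "T_operation K A (\<lambda>p q a b. f p q a b \<ominus>\<^bsub>A (p * q)\<^esub> g p q a b)"
  using T_operation.T_operation_add[OF assms(1) T_operation.T_operation_uminus[OF assms(2)]]
  by (simp add: a_minus_def)

lemma (in Zinbiel_T_algebra) comm_T_algebra_anticommutator:
  "comm_T_algebra K A (\<lambda>p q a b. star p q a b \<oplus>\<^bsub>A (p * q)\<^esub> star q p b a)"
proof -
  interpret S: T_operation K A "\<lambda>p q a b. star p q a b \<oplus>\<^bsub>A (p * q)\<^esub> star q p b a"
    by (rule T_operation_add[OF T_operation_opposite])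
  show ?thesis
  proof
    fix p q t a b c
    assume [simp]: "a \<in> carrier (A p)" "b \<in> carrier (A q)" "c \<in> carrier (A t)"
    \<comment> \<open>These four instances rewrite all right-nested products in the goal. Both sides
      then consist of the six left-nested products, one for each permutation of \<open>a\<close>,
      \<open>b\<close>, \<open>c\<close>.\<close>
    note z = zinbiel[of a p b q c t] zinbiel[of a p c t b q] zinbiel[of c t b q a p]
      zinbiel[of c t a p b q]
    show "star (p * q) t (star p q a b \<oplus>\<^bsub>A (p * q)\<^esub> star q p b a) c \<oplus>\<^bsub>A (p * q * t)\<^esub>
       star t (p * q) c (star p q a b \<oplus>\<^bsub>A (p * q)\<^esub> star q p b a) =
       star p (q * t) a (star q t b c \<oplus>\<^bsub>A (q * t)\<^esub> star t q c b) \<oplus>\<^bsub>A (p * (q * t))\<^esub>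
       star (q * t) p (star q t b c \<oplus>\<^bsub>A (q * t)\<^esub> star t q c b) a"
      using z by (simp add: closed_at add_left add_right index_ac member_ac member_simps)
  qed (auto simp: closed_at index_ac member_ac)
qed

context pre_Lie_T_algebra
begin

text \<open>Identities between differences are restated as identities between sums, which can be
  added up and compared by associativity and commutativity alone.\<close>

lemma pre_Lie_add:
  assumes "a \<in> carrier (A p)" "b \<in> carrier (A q)" "c \<in> carrier (A t)"
  shows "ast p (q * t) a (ast q t b c) \<oplus>\<^bsub>A (p * q * t)\<^esub> ast (q * p) t (ast q p b a) c =
    ast q (p * t) b (ast p t a c) \<oplus>\<^bsub>A (p * q * t)\<^esub> ast (p * q) t (ast p q a b) c"
  using pre_Lie[OF assms] assms
  by (simp add: closed_at index_ac member_simps member_diff_simps member_ac)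

lemma Lie_T_algebra_commutator:
  "Lie_T_algebra K A (\<lambda>p q a b. ast p q a b \<ominus>\<^bsub>A (p * q)\<^esub> ast q p b a)"
proof -
  interpret S: T_operation K A "\<lambda>p q a b. ast p q a b \<ominus>\<^bsub>A (p * q)\<^esub> ast q p b a"
    by (rule T_operation_diff[OF T_operation_axioms T_operation_opposite])
  show ?thesis
  proof
    fix p q a b
    assume "a \<in> carrier (A p)" "b \<in> carrier (A q)"
    then show "ast p q a b \<ominus>\<^bsub>A (p * q)\<^esub> ast q p b a \<oplus>\<^bsub>A (p * q)\<^esub>
        (ast q p b a \<ominus>\<^bsub>A (q * p)\<^esub> ast p q a b) = \<zero>\<^bsub>A (p * q)\<^esub>"
      by (simp add: closed_at index_ac member_simps member_diff_simps member_ac)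
  next
    fix p q t a b c
    assume [simp]: "a \<in> carrier (A p)" "b \<in> carrier (A q)" "c \<in> carrier (A t)"
    let ?add = "\<lambda>x y. x \<oplus>\<^bsub>A (p * q * t)\<^esub> y"
    \<comment> \<open>Adds the three equations side by side. In the expanded Jacobi sum, the six
      terms with a minus sign form the left side of this total and the six with a plus sign form its
      right side.\<close>
    note cyclic = arg_cong2[where f = ?add,
        OF arg_cong2[where f = ?add, OF pre_Lie_add[of a p b q c t] pre_Lie_add[of b q c t a p]]
          pre_Lie_add[of c t a p b q]]
    show "(ast (p * q) t (ast p q a b \<ominus>\<^bsub>A (p * q)\<^esub> ast q p b a) c
        \<ominus>\<^bsub>A (p * q * t)\<^esub> ast t (p * q) c (ast p q a b \<ominus>\<^bsub>A (p * q)\<^esub> ast q p b a))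
      \<oplus>\<^bsub>A (p * q * t)\<^esub> (ast (q * t) p (ast q t b c \<ominus>\<^bsub>A (q * t)\<^esub> ast t q c b) a
        \<ominus>\<^bsub>A (q * t * p)\<^esub> ast p (q * t) a (ast q t b c \<ominus>\<^bsub>A (q * t)\<^esub> ast t q c b))
      \<oplus>\<^bsub>A (p * q * t)\<^esub> (ast (t * p) q (ast t p c a \<ominus>\<^bsub>A (t * p)\<^esub> ast p t a c) b
        \<ominus>\<^bsub>A (t * p * q)\<^esub> ast q (t * p) b (ast t p c a \<ominus>\<^bsub>A (t * p)\<^esub> ast p t a c))
      = \<zero>\<^bsub>A (p * q * t)\<^esub>"
      using cyclic
      by (simp add: closed_at diff_left diff_right index_ac member_simps member_diff_simps member_ac)
  qed
qed

end

text \<open>The subtracted terms are moved across so that this identity can be added to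
  \<open>compat_ast\<close>, which contains no differences.\<close>

lemma (in pre_Poisson_T_algebra) compat_star_add:
  assumes "a \<in> carrier (A p)" "b \<in> carrier (A q)" "c \<in> carrier (A t)"
  shows "star (p * q) t (ast p q a b) c \<oplus>\<^bsub>A (p * q * t)\<^esub> star q (p * t) b (ast p t a c) =
    ast p (q * t) a (star q t b c) \<oplus>\<^bsub>A (p * q * t)\<^esub> star (q * p) t (ast q p b a) c"
  using compat_star[OF assms] assms
  by (simp add: closed_at pre_Lie.closed_at index_ac member_simps member_diff_simps member_ac)

lemma (in pre_Poisson_T_algebra) Poisson_T_algebra_commutators:
  "Poisson_T_algebra K A
    (\<lambda>p q a b. star p q a b \<oplus>\<^bsub>A (p * q)\<^esub> star q p b a)
    (\<lambda>p q a b. ast p q a b \<ominus>\<^bsub>A (p * q)\<^esub> ast q p b a)"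
proof (intro Poisson_T_algebra.intro Poisson_T_algebra_axioms.intro
    comm_T_algebra_anticommutator pre_Lie.Lie_T_algebra_commutator)
  fix p q t a b c
  assume [simp]: "a \<in> carrier (A p)" "b \<in> carrier (A q)" "c \<in> carrier (A t)"
  let ?add = "\<lambda>x y. x \<oplus>\<^bsub>A (p * q * t)\<^esub> y"
  \<comment> \<open>The expanded Leibniz rule has twelve terms. The first two instances account for
    eight; \<open>compat_ast\<close> supplies the other four, namely those with a
    \<open>star\<close> product of \<open>b\<close> and \<open>c\<close> as left argument of
    \<open>ast\<close>, and those with \<open>ast q p b a\<close> or \<open>ast t p c a\<close> as
    right argument of \<open>star\<close>.\<close>
  note total = arg_cong2[where f = ?add,
      OF arg_cong2[where f = ?add, OF compat_star_add[of a p b q c t] compat_star_add[of a p c t b q]]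
        compat_ast[of b q c t a p]]
  show "ast p (q * t) a (star q t b c \<oplus>\<^bsub>A (q * t)\<^esub> star t q c b)
      \<ominus>\<^bsub>A (p * (q * t))\<^esub> ast (q * t) p (star q t b c \<oplus>\<^bsub>A (q * t)\<^esub> star t q c b) a =
    star (p * q) t (ast p q a b \<ominus>\<^bsub>A (p * q)\<^esub> ast q p b a) c
      \<oplus>\<^bsub>A (p * q * t)\<^esub> star t (p * q) c (ast p q a b \<ominus>\<^bsub>A (p * q)\<^esub> ast q p b a)
      \<oplus>\<^bsub>A (p * q * t)\<^esub> (star q (p * t) b (ast p t a c \<ominus>\<^bsub>A (p * t)\<^esub> ast t p c a)
      \<oplus>\<^bsub>A (q * (p * t))\<^esub> star (p * t) q (ast p t a c \<ominus>\<^bsub>A (p * t)\<^esub> ast t p c a) b)"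
    using total
    by (simp add: closed_at pre_Lie.closed_at add_left add_right diff_left diff_right
        pre_Lie.add_left pre_Lie.add_right index_ac member_simps member_diff_simps member_ac)
qed

theorem proposition4p22:
  fixes K :: "('k, 'r) ring_scheme"
    and A :: "'p::ab_semigroup_mult \<Rightarrow> ('k, 'v, 'm) module_scheme"
    and star ast :: "'p \<Rightarrow> 'p \<Rightarrow> 'v \<Rightarrow> 'v \<Rightarrow> 'v"
  assumes "pre_Poisson_T_algebra K A star ast"
  shows "Poisson_T_algebra K A
    (\<lambda>p q a b. star p q a b \<oplus>\<^bsub>A (p * q)\<^esub> star q p b a)
    (\<lambda>p q a b. ast p q a b \<ominus>\<^bsub>A (p * q)\<^esub> ast q p b a)"
  using assms by (rule pre_Poisson_T_algebra.Poisson_T_algebra_commutators)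

end
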